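(* Let $\mathbb{A}$ be a symmetric strict monoidal category with braiding $\sigma$, and let $\mathcal{C}(\mathbb{A})$ be its free cornering. For every cell $\alpha$ of $\mathcal{C}(\mathbb{A})$, with top boundary $A$, bottom boundary $B$, left boundary $X$ and right boundary $Y$, and every object $C$ of $\mathbb{A}$, the crossing cells $\chi_{C,X},\chi_{C,Y}$ satisfy $$\frac{\chi_{C,X}\,\vert\,\alpha}{\ulcorner\sigma_{C,B}\urcorner}\;=\;\frac{\ulcorner\sigma_{C,A}\urcorner}{\alpha\,\vert\,\chi_{C,Y}} .$$
   Context: Single-object double categories. A single-object double category $\mathbb{D}$ consists of a monoid $(\mathbb{D}_H,\otimes,I)$ of horizontal edges, a monoid $(\mathbb{D}_V,\otimes,I)$ of vertical edges, and cells $\alpha$, each with a top and a bottom boundary in $\mathbb{D}_H$ and a left and a right boundary in $\mathbb{D}_V$. If the right boundary of $\alpha$ equals the left boundary of $\beta$ there is a horizontal composite $\alpha\vert\beta$ (top/bottom boundaries are multiplied in the order $\alpha,\beta$; left boundary that of $\alpha$, right boundary that of $\beta$). If the bottom boundary of $\alpha$ equals the top boundary of $\beta$ there is a vertical composite $\frac{\alpha}{\beta}$ (left/right boundaries multiplied in the order $\alpha,\beta$; top that of $\alpha$, bottom that of $\beta$). Both compositions are associative and unital, with identity cells $1_A$ for $A\in\mathbb{D}_H$ (top $=$ bottom $=A$, left $=$ right $=I$; identities for vertical composition) and $1_X$ for $X\in\mathbb{D}_V$ (left $=$ right $=X$, top $=$ bottom $=I$; identities for horizontal composition), with $1_A\vert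 1_B=1_{A\otimes B}$, $\frac{1_X}{1_Y}=1_{X\otimes Y}$, the two identity cells on $I$ coincide, and the interchange law $\frac{\alpha}{\beta}\big\vert\frac{\gamma}{\delta}=\frac{\alpha\vert\gamma}{\beta\vert\delta}$ holds. Free cornering. For a symmetric strict monoidal category $\mathbb{A}$ (with object set $\mathbb{A}_0$ and braiding $\sigma_{A,B}:A\otimes B\to B\otimes A$), $\mathcal{C}(\mathbb{A})$ is the free single-object double category determined by: horizontal edge monoid $(\mathbb{A}_0,\otimes,I)$; vertical edge monoid the free monoid $\mathbb{A}^{\circ\bullet}=(\mathbb{A}_0\times\{\circ,\bullet\})^*$, with generators written $A^\circ$, $A^\bullet$, product written $\otimes$ and unit $I$; generating cells, for each $A\in\mathbb{A}_0$, the corners (boundaries not mentioned are $I$) - $s^\circ_A$: top $A$, right $A^\circ$; $\quad r^\circ_A$: left $A^\circ$, bottom $A$; - $s^\bullet_A$: top $A$, left $A^\bullet$; $\quad r^\bullet_A$: right $A^\bullet$, bottom $A$; and, for each morphism $f:A\to B$ of $\mathbb{A}$, a cell $\ulcorner f\urcorner$ with top $A$, bottom $B$; subject to the yanking equations $s^\circ_A\vert r^\circ_A=1_A$, $\frac{r^\circ_A}{s^\circ_A}=1_{A^\circ}$, $r^\bullet_A\vert s^\bullet_A=1_A$, $\frac{r^\bullet_A}{s^\bullet_A}=1_{A^\bullet}$, and the equations $\frac{\ulcorner f\urcorner}{\ulcorner g\urcorner}=\ulcorner f;g\urcorner$ (for composable $f,g$; $f;g$ is "first $f$ then $g$"), $\ulcorner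 1_A\urcorner=1_A$, $\ulcorner f\urcorner\vert\ulcorner g\urcorner=\ulcorner f\otimes g\urcorner$. Crossing cells. For $C\in\mathbb{A}_0$ and $X\in\mathbb{A}^{\circ\bullet}$, the crossing cell $\chi_{C,X}$ (top $=$ bottom $=C$, left $=$ right $=X$) is defined inductively: $\chi_{C,A^\circ}$ is the vertical composite, from top to bottom, of $r^\circ_A\vert 1_C$, $\ulcorner\sigma_{A,C}\urcorner$, $1_C\vert s^\circ_A$; $\chi_{C,A^\bullet}$ is the vertical composite, from top to bottom, of $1_C\vert r^\bullet_A$, $\ulcorner\sigma_{C,A}\urcorner$, $s^\bullet_A\vert 1_C$; $\chi_{C,I}=1_C$; and $\chi_{C,X\otimes Y}=\frac{\chi_{C,X}}{\chi_{C,Y}}$. *)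

theory Defs
  imports "HOL-Algebra.Group"
begin

section \<open>Symmetric strict monoidal categories\<close>

text \<open>Composition \<open>f ;; g\<close> is in diagrammatic order; \<open>\<odot>\<close> is the tensor of morphisms, while the
  tensor of objects is the multiplication of the monoid \<open>obj\<close>. Objects and morphisms are
  given by carrier sets, and the operations are only constrained on them.\<close>

record ('o, 'm) smc =
  obj :: "'o monoid"
  arr :: "'m set"
  src :: "'m \<Rightarrow> 'o"
  tgt :: "'m \<Rightarrow> 'o"
  idm :: "'o \<Rightarrow> 'm"
  cmp :: "'m \<Rightarrow> 'm \<Rightarrow> 'm"  (infixl ";;\<index>" 60)
  tns :: "'m \<Rightarrow> 'm \<Rightarrow> 'm"  (infixl "\<odot>\<index>" 70)
  brd :: "'o \<Rightarrow> 'o \<Rightarrow> 'm"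

text \<open>The remaining coherence laws (the other hexagon, \<open>\<sigma>\<^sub>I\<^sub>,\<^sub>A = \<sigma>\<^sub>A\<^sub>,\<^sub>I = 1\<^sub>A\<close>) follow from
  \<open>hexagon\<close> and \<open>symmetry\<close>.\<close>

locale symmetric_strict_monoidal_category =
  objects: monoid "obj A" for A :: "('o, 'm) smc" (structure) +
  assumes src_closed: "f \<in> arr A \<Longrightarrow> src A f \<in> carrier (obj A)"
    and tgt_closed: "f \<in> arr A \<Longrightarrow> tgt A f \<in> carrier (obj A)"
    and idm_arr: "a \<in> carrier (obj A) \<Longrightarrow> idm A a \<in> arr A"
    and idm_src: "a \<in> carrier (obj A) \<Longrightarrow> src A (idm A a) = a"
    and idm_tgt: "a \<in> carrier (obj A) \<Longrightarrow> tgt A (idm A a) = a"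
    and cmp_arr: "\<lbrakk>f \<in> arr A; g \<in> arr A; tgt A f = src A g\<rbrakk> \<Longrightarrow> f ;; g \<in> arr A"
    and cmp_src: "\<lbrakk>f \<in> arr A; g \<in> arr A; tgt A f = src A g\<rbrakk> \<Longrightarrow> src A (f ;; g) = src A f"
    and cmp_tgt: "\<lbrakk>f \<in> arr A; g \<in> arr A; tgt A f = src A g\<rbrakk> \<Longrightarrow> tgt A (f ;; g) = tgt A g"
    and cmp_assoc: "\<lbrakk>f \<in> arr A; g \<in> arr A; k \<in> arr A; tgt A f = src A g; tgt A g = src A k\<rbrakk>
          \<Longrightarrow> (f ;; g) ;; k = f ;; (g ;; k)"
    and cmp_idm_left: "f \<in> arr A \<Longrightarrow> idm A (src A f) ;; f = f"
    and cmp_idm_right: "f \<in> arr A \<Longrightarrow> f ;; idm A (tgt A f) = f"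
    and tns_arr: "\<lbrakk>f \<in> arr A; g \<in> arr A\<rbrakk> \<Longrightarrow> f \<odot> g \<in> arr A"
    and tns_src: "\<lbrakk>f \<in> arr A; g \<in> arr A\<rbrakk> \<Longrightarrow> src A (f \<odot> g) = src A f \<otimes>\<^bsub>obj A\<^esub> src A g"
    and tns_tgt: "\<lbrakk>f \<in> arr A; g \<in> arr A\<rbrakk> \<Longrightarrow> tgt A (f \<odot> g) = tgt A f \<otimes>\<^bsub>obj A\<^esub> tgt A g"
    and tns_idm: "\<lbrakk>a \<in> carrier (obj A); b \<in> carrier (obj A)\<rbrakk>
          \<Longrightarrow> idm A a \<odot> idm A b = idm A (a \<otimes>\<^bsub>obj A\<^esub> b)"
    and tns_cmp: "\<lbrakk>f \<in> arr A; f' \<in> arr A; g \<in> arr A; g' \<in> arr A;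
          tgt A f = src A f'; tgt A g = src A g'\<rbrakk>
          \<Longrightarrow> (f ;; f') \<odot> (g ;; g') = (f \<odot> g) ;; (f' \<odot> g')"
    and tns_assoc: "\<lbrakk>f \<in> arr A; g \<in> arr A; k \<in> arr A\<rbrakk> \<Longrightarrow> (f \<odot> g) \<odot> k = f \<odot> (g \<odot> k)"
    and tns_unit_left: "f \<in> arr A \<Longrightarrow> idm A \<one>\<^bsub>obj A\<^esub> \<odot> f = f"
    and tns_unit_right: "f \<in> arr A \<Longrightarrow> f \<odot> idm A \<one>\<^bsub>obj A\<^esub> = f"
    and brd_arr: "\<lbrakk>a \<in> carrier (obj A); b \<in> carrier (obj A)\<rbrakk> \<Longrightarrow> brd A a b \<in> arr A"
    and brd_src: "\<lbrakk>a \<in> carrier (obj A); b \<in> carrier (obj A)\<rbrakk>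
          \<Longrightarrow> src A (brd A a b) = a \<otimes>\<^bsub>obj A\<^esub> b"
    and brd_tgt: "\<lbrakk>a \<in> carrier (obj A); b \<in> carrier (obj A)\<rbrakk>
          \<Longrightarrow> tgt A (brd A a b) = b \<otimes>\<^bsub>obj A\<^esub> a"
    and brd_natural: "\<lbrakk>f \<in> arr A; g \<in> arr A\<rbrakk>
          \<Longrightarrow> (f \<odot> g) ;; brd A (tgt A f) (tgt A g) = brd A (src A f) (src A g) ;; (g \<odot> f)"
    and hexagon: "\<lbrakk>a \<in> carrier (obj A); b \<in> carrier (obj A); c \<in> carrier (obj A)\<rbrakk>
          \<Longrightarrow> brd A a (b \<otimes>\<^bsub>obj A\<^esub> c) = (brd A a b \<odot> idm A c) ;; (idm A b \<odot> brd A a c)"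
    and symmetry: "\<lbrakk>a \<in> carrier (obj A); b \<in> carrier (obj A)\<rbrakk>
          \<Longrightarrow> brd A a b ;; brd A b a = idm A (a \<otimes>\<^bsub>obj A\<^esub> b)"


section \<open>Single-object double categories\<close>

text \<open>\<open>\<alpha> \<parallel> \<beta>\<close> is the horizontal composite \<open>\<alpha> | \<beta>\<close>, and \<open>\<alpha> \<oslash> \<beta>\<close> the vertical composite with
  \<open>\<alpha>\<close> on top of \<open>\<beta>\<close>. \<open>hid\<close> gives the identity cells on horizontal edges (the identities for
  vertical composition), \<open>vid\<close> those on vertical edges.\<close>

record ('h, 'v, 'c) sodc =
  hor :: "'h monoid"
  ver :: "'v monoid"
  cells :: "'c set"
  top_of :: "'c \<Rightarrow> 'h"
  bot_of :: "'c \<Rightarrow> 'h"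
  left_of :: "'c \<Rightarrow> 'v"
  right_of :: "'c \<Rightarrow> 'v"
  hcomp :: "'c \<Rightarrow> 'c \<Rightarrow> 'c"  (infixl "\<parallel>\<index>" 65)
  vcomp :: "'c \<Rightarrow> 'c \<Rightarrow> 'c"  (infixl "\<oslash>\<index>" 60)
  hid :: "'h \<Rightarrow> 'c"
  vid :: "'v \<Rightarrow> 'c"

locale single_object_double_category =
  H: monoid "hor D" + V: monoid "ver D" for D :: "('h, 'v, 'c) sodc" (structure) +
  assumes boundary_closed:
      "\<alpha> \<in> cells D \<Longrightarrow> top_of D \<alpha> \<in> carrier (hor D)"
      "\<alpha> \<in> cells D \<Longrightarrow> bot_of D \<alpha> \<in> carrier (hor D)"
      "\<alpha> \<in> cells D \<Longrightarrow> left_of D \<alpha> \<in> carrier (ver D)"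
      "\<alpha> \<in> cells D \<Longrightarrow> right_of D \<alpha> \<in> carrier (ver D)"
    and hcomp_boundary:
      "\<lbrakk>\<alpha> \<in> cells D; \<beta> \<in> cells D; right_of D \<alpha> = left_of D \<beta>\<rbrakk> \<Longrightarrow> \<alpha> \<parallel> \<beta> \<in> cells D"
      "\<lbrakk>\<alpha> \<in> cells D; \<beta> \<in> cells D; right_of D \<alpha> = left_of D \<beta>\<rbrakk>
         \<Longrightarrow> top_of D (\<alpha> \<parallel> \<beta>) = top_of D \<alpha> \<otimes>\<^bsub>hor D\<^esub> top_of D \<beta>"
      "\<lbrakk>\<alpha> \<in> cells D; \<beta> \<in> cells D; right_of D \<alpha> = left_of D \<beta>\<rbrakk>
         \<Longrightarrow> bot_of D (\<alpha> \<parallel> \<beta>) = bot_of D \<alpha> \<otimes>\<^bsub>hor D\<^esub> bot_of D \<beta>"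
      "\<lbrakk>\<alpha> \<in> cells D; \<beta> \<in> cells D; right_of D \<alpha> = left_of D \<beta>\<rbrakk>
         \<Longrightarrow> left_of D (\<alpha> \<parallel> \<beta>) = left_of D \<alpha>"
      "\<lbrakk>\<alpha> \<in> cells D; \<beta> \<in> cells D; right_of D \<alpha> = left_of D \<beta>\<rbrakk>
         \<Longrightarrow> right_of D (\<alpha> \<parallel> \<beta>) = right_of D \<beta>"
    and vcomp_boundary:
      "\<lbrakk>\<alpha> \<in> cells D; \<beta> \<in> cells D; bot_of D \<alpha> = top_of D \<beta>\<rbrakk> \<Longrightarrow> \<alpha> \<oslash> \<beta> \<in> cells D"
      "\<lbrakk>\<alpha> \<in> cells D; \<beta> \<in> cells D; bot_of D \<alpha> = top_of D \<beta>\<rbrakk>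
         \<Longrightarrow> top_of D (\<alpha> \<oslash> \<beta>) = top_of D \<alpha>"
      "\<lbrakk>\<alpha> \<in> cells D; \<beta> \<in> cells D; bot_of D \<alpha> = top_of D \<beta>\<rbrakk>
         \<Longrightarrow> bot_of D (\<alpha> \<oslash> \<beta>) = bot_of D \<beta>"
      "\<lbrakk>\<alpha> \<in> cells D; \<beta> \<in> cells D; bot_of D \<alpha> = top_of D \<beta>\<rbrakk>
         \<Longrightarrow> left_of D (\<alpha> \<oslash> \<beta>) = left_of D \<alpha> \<otimes>\<^bsub>ver D\<^esub> left_of D \<beta>"
      "\<lbrakk>\<alpha> \<in> cells D; \<beta> \<in> cells D; bot_of D \<alpha> = top_of D \<beta>\<rbrakk>
         \<Longrightarrow> right_of D (\<alpha> \<oslash> \<beta>) = right_of D \<alpha> \<otimes>\<^bsub>ver D\<^esub> right_of D \<beta>"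
    and hid_boundary:
      "a \<in> carrier (hor D) \<Longrightarrow> hid D a \<in> cells D"
      "a \<in> carrier (hor D) \<Longrightarrow> top_of D (hid D a) = a"
      "a \<in> carrier (hor D) \<Longrightarrow> bot_of D (hid D a) = a"
      "a \<in> carrier (hor D) \<Longrightarrow> left_of D (hid D a) = \<one>\<^bsub>ver D\<^esub>"
      "a \<in> carrier (hor D) \<Longrightarrow> right_of D (hid D a) = \<one>\<^bsub>ver D\<^esub>"
    and vid_boundary:
      "x \<in> carrier (ver D) \<Longrightarrow> vid D x \<in> cells D"
      "x \<in> carrier (ver D) \<Longrightarrow> top_of D (vid D x) = \<one>\<^bsub>hor D\<^esub>"
      "x \<in> carrier (ver D) \<Longrightarrow> bot_of D (vid D x) = \<one>\<^bsub>hor D\<^esub>"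
      "x \<in> carrier (ver D) \<Longrightarrow> left_of D (vid D x) = x"
      "x \<in> carrier (ver D) \<Longrightarrow> right_of D (vid D x) = x"
    and hcomp_assoc: "\<lbrakk>\<alpha> \<in> cells D; \<beta> \<in> cells D; \<gamma> \<in> cells D;
          right_of D \<alpha> = left_of D \<beta>; right_of D \<beta> = left_of D \<gamma>\<rbrakk>
          \<Longrightarrow> (\<alpha> \<parallel> \<beta>) \<parallel> \<gamma> = \<alpha> \<parallel> (\<beta> \<parallel> \<gamma>)"
    and vcomp_assoc: "\<lbrakk>\<alpha> \<in> cells D; \<beta> \<in> cells D; \<gamma> \<in> cells D;
          bot_of D \<alpha> = top_of D \<beta>; bot_of D \<beta> = top_of D \<gamma>\<rbrakk>
          \<Longrightarrow> (\<alpha> \<oslash> \<beta>) \<oslash> \<gamma> = \<alpha> \<oslash> (\<beta> \<oslash> \<gamma>)"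
    and hcomp_unit: "\<alpha> \<in> cells D \<Longrightarrow> vid D (left_of D \<alpha>) \<parallel> \<alpha> = \<alpha>"
      "\<alpha> \<in> cells D \<Longrightarrow> \<alpha> \<parallel> vid D (right_of D \<alpha>) = \<alpha>"
    and vcomp_unit: "\<alpha> \<in> cells D \<Longrightarrow> hid D (top_of D \<alpha>) \<oslash> \<alpha> = \<alpha>"
      "\<alpha> \<in> cells D \<Longrightarrow> \<alpha> \<oslash> hid D (bot_of D \<alpha>) = \<alpha>"
    and hid_mult: "\<lbrakk>a \<in> carrier (hor D); b \<in> carrier (hor D)\<rbrakk>
          \<Longrightarrow> hid D a \<parallel> hid D b = hid D (a \<otimes>\<^bsub>hor D\<^esub> b)"
    and vid_mult: "\<lbrakk>x \<in> carrier (ver D); y \<in> carrier (ver D)\<rbrakk>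
          \<Longrightarrow> vid D x \<oslash> vid D y = vid D (x \<otimes>\<^bsub>ver D\<^esub> y)"
    and hid_vid_one: "hid D \<one>\<^bsub>hor D\<^esub> = vid D \<one>\<^bsub>ver D\<^esub>"
    and interchange: "\<lbrakk>\<alpha> \<in> cells D; \<beta> \<in> cells D; \<gamma> \<in> cells D; \<delta> \<in> cells D;
          bot_of D \<alpha> = top_of D \<beta>; bot_of D \<gamma> = top_of D \<delta>;
          right_of D \<alpha> = left_of D \<gamma>; right_of D \<beta> = left_of D \<delta>\<rbrakk>
          \<Longrightarrow> (\<alpha> \<oslash> \<beta>) \<parallel> (\<gamma> \<oslash> \<delta>) = (\<alpha> \<parallel> \<gamma>) \<oslash> (\<beta> \<parallel> \<delta>)"


section \<open>The free cornering\<close>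

datatype polarity = Circ | Bullet

type_synonym 'o vedge = "('o \<times> polarity) list"

definition exchange_monoid :: "('o, 'm) smc \<Rightarrow> 'o vedge monoid" where
  "exchange_monoid A = \<lparr>carrier = lists (carrier (obj A) \<times> UNIV), mult = (@), one = []\<rparr>"

text \<open>\<open>S p a\<close> and \<open>R p a\<close> stand for the corners \<open>s\<^sup>p\<^sub>a\<close> and \<open>r\<^sup>p\<^sub>a\<close>.\<close>

datatype ('o, 'm) cell_term =
    HId 'o
  | VId "'o vedge"
  | S polarity 'o
  | R polarity 'o
  | Box 'm
  | HComp "('o, 'm) cell_term" "('o, 'm) cell_term"
  | VComp "('o, 'm) cell_term" "('o, 'm) cell_term"

primrec t_top :: "('o, 'm) smc \<Rightarrow> ('o, 'm) cell_term \<Rightarrow> 'o" where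
  "t_top A (HId a) = a"
| "t_top A (VId x) = \<one>\<^bsub>obj A\<^esub>"
| "t_top A (S p a) = a"
| "t_top A (R p a) = \<one>\<^bsub>obj A\<^esub>"
| "t_top A (Box f) = src A f"
| "t_top A (HComp s t) = t_top A s \<otimes>\<^bsub>obj A\<^esub> t_top A t"
| "t_top A (VComp s t) = t_top A s"

primrec t_bot :: "('o, 'm) smc \<Rightarrow> ('o, 'm) cell_term \<Rightarrow> 'o" where
  "t_bot A (HId a) = a"
| "t_bot A (VId x) = \<one>\<^bsub>obj A\<^esub>"
| "t_bot A (S p a) = \<one>\<^bsub>obj A\<^esub>"
| "t_bot A (R p a) = a"
| "t_bot A (Box f) = tgt A f"
| "t_bot A (HComp s t) = t_bot A s \<otimes>\<^bsub>obj A\<^esub> t_bot A t"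
| "t_bot A (VComp s t) = t_bot A t"

primrec t_left :: "('o, 'm) cell_term \<Rightarrow> 'o vedge" where
  "t_left (HId a) = []"
| "t_left (VId x) = x"
| "t_left (S p a) = (case p of Circ \<Rightarrow> [] | Bullet \<Rightarrow> [(a, Bullet)])"
| "t_left (R p a) = (case p of Circ \<Rightarrow> [(a, Circ)] | Bullet \<Rightarrow> [])"
| "t_left (Box f) = []"
| "t_left (HComp s t) = t_left s"
| "t_left (VComp s t) = t_left s @ t_left t"

primrec t_right :: "('o, 'm) cell_term \<Rightarrow> 'o vedge" where
  "t_right (HId a) = []"
| "t_right (VId x) = x"
| "t_right (S p a) = (case p of Circ \<Rightarrow> [(a, Circ)] | Bullet \<Rightarrow> [])"
| "t_right (R p a) = (case p of Circ \<Rightarrow> [] | Bullet \<Rightarrow> [(a, Bullet)])"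
| "t_right (Box f) = []"
| "t_right (HComp s t) = t_right t"
| "t_right (VComp s t) = t_right s @ t_right t"

primrec wf_term :: "('o, 'm) smc \<Rightarrow> ('o, 'm) cell_term \<Rightarrow> bool" where
  "wf_term A (HId a) \<longleftrightarrow> a \<in> carrier (obj A)"
| "wf_term A (VId x) \<longleftrightarrow> x \<in> carrier (exchange_monoid A)"
| "wf_term A (S p a) \<longleftrightarrow> a \<in> carrier (obj A)"
| "wf_term A (R p a) \<longleftrightarrow> a \<in> carrier (obj A)"
| "wf_term A (Box f) \<longleftrightarrow> f \<in> arr A"
| "wf_term A (HComp s t) \<longleftrightarrow> wf_term A s \<and> wf_term A t \<and> t_right s = t_left t"
| "wf_term A (VComp s t) \<longleftrightarrow> wf_term A s \<and> wf_term A t \<and> t_bot A s = t_top A t"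

text \<open>The congruence on well-formed terms generated by the laws of a single-object double category
  and the defining equations of the free cornering.\<close>

inductive cell_eq :: "('o, 'm) smc \<Rightarrow> ('o, 'm) cell_term \<Rightarrow> ('o, 'm) cell_term \<Rightarrow> bool"
  for A :: "('o, 'm) smc" where
  refl: "wf_term A t \<Longrightarrow> cell_eq A t t"
| sym: "cell_eq A s t \<Longrightarrow> cell_eq A t s"
| trans: "\<lbrakk>cell_eq A s t; cell_eq A t u\<rbrakk> \<Longrightarrow> cell_eq A s u"
| hcong: "\<lbrakk>cell_eq A s s'; cell_eq A t t'; wf_term A (HComp s t)\<rbrakk>
    \<Longrightarrow> cell_eq A (HComp s t) (HComp s' t')"
| vcong: "\<lbrakk>cell_eq A s s'; cell_eq A t t'; wf_term A (VComp s t)\<rbrakk>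
    \<Longrightarrow> cell_eq A (VComp s t) (VComp s' t')"
| hassoc: "wf_term A (HComp (HComp s t) u)
    \<Longrightarrow> cell_eq A (HComp (HComp s t) u) (HComp s (HComp t u))"
| vassoc: "wf_term A (VComp (VComp s t) u)
    \<Longrightarrow> cell_eq A (VComp (VComp s t) u) (VComp s (VComp t u))"
| hunit_left: "wf_term A t \<Longrightarrow> cell_eq A (HComp (VId (t_left t)) t) t"
| hunit_right: "wf_term A t \<Longrightarrow> cell_eq A (HComp t (VId (t_right t))) t"
| vunit_top: "wf_term A t \<Longrightarrow> cell_eq A (VComp (HId (t_top A t)) t) t"
| vunit_bot: "wf_term A t \<Longrightarrow> cell_eq A (VComp t (HId (t_bot A t))) t"
| hid_mult: "\<lbrakk>a \<in> carrier (obj A); b \<in> carrier (obj A)\<rbrakk>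
    \<Longrightarrow> cell_eq A (HComp (HId a) (HId b)) (HId (a \<otimes>\<^bsub>obj A\<^esub> b))"
| vid_mult: "\<lbrakk>x \<in> carrier (exchange_monoid A); y \<in> carrier (exchange_monoid A)\<rbrakk>
    \<Longrightarrow> cell_eq A (VComp (VId x) (VId y)) (VId (x @ y))"
| hid_vid_one: "cell_eq A (HId \<one>\<^bsub>obj A\<^esub>) (VId [])"
| interchange: "\<lbrakk>wf_term A (VComp s t); wf_term A (VComp s' t');
      t_right s = t_left s'; t_right t = t_left t'\<rbrakk>
    \<Longrightarrow> cell_eq A (HComp (VComp s t) (VComp s' t')) (VComp (HComp s s') (HComp t t'))"
| yank_h_circ: "a \<in> carrier (obj A) \<Longrightarrow> cell_eq A (HComp (S Circ a) (R Circ a)) (HId a)"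
| yank_v_circ: "a \<in> carrier (obj A) \<Longrightarrow> cell_eq A (VComp (R Circ a) (S Circ a)) (VId [(a, Circ)])"
| yank_h_bullet: "a \<in> carrier (obj A) \<Longrightarrow> cell_eq A (HComp (R Bullet a) (S Bullet a)) (HId a)"
| yank_v_bullet: "a \<in> carrier (obj A)
    \<Longrightarrow> cell_eq A (VComp (R Bullet a) (S Bullet a)) (VId [(a, Bullet)])"
| box_cmp: "\<lbrakk>f \<in> arr A; g \<in> arr A; tgt A f = src A g\<rbrakk>
    \<Longrightarrow> cell_eq A (VComp (Box f) (Box g)) (Box (cmp A f g))"
| box_idm: "a \<in> carrier (obj A) \<Longrightarrow> cell_eq A (Box (idm A a)) (HId a)"
| box_tns: "\<lbrakk>f \<in> arr A; g \<in> arr A\<rbrakk>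
    \<Longrightarrow> cell_eq A (HComp (Box f) (Box g)) (Box (tns A f g))"

definition cls :: "('o, 'm) smc \<Rightarrow> ('o, 'm) cell_term \<Rightarrow> ('o, 'm) cell_term set" where
  "cls A t = {u. cell_eq A t u}"

definition rep :: "('o, 'm) cell_term set \<Rightarrow> ('o, 'm) cell_term" where
  "rep \<alpha> = (SOME t. t \<in> \<alpha>)"

definition free_cornering ::
    "('o, 'm) smc \<Rightarrow> ('o, 'o vedge, ('o, 'm) cell_term set) sodc" where
  "free_cornering A = \<lparr>
     hor = obj A,
     ver = exchange_monoid A,
     cells = {t. wf_term A t} // {(s, t). cell_eq A s t},
     top_of = (\<lambda>\<alpha>. t_top A (rep \<alpha>)),
     bot_of = (\<lambda>\<alpha>. t_bot A (rep \<alpha>)),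
     left_of = (\<lambda>\<alpha>. t_left (rep \<alpha>)),
     right_of = (\<lambda>\<alpha>. t_right (rep \<alpha>)),
     hcomp = (\<lambda>\<alpha> \<beta>. cls A (HComp (rep \<alpha>) (rep \<beta>))),
     vcomp = (\<lambda>\<alpha> \<beta>. cls A (VComp (rep \<alpha>) (rep \<beta>))),
     hid = (\<lambda>a. cls A (HId a)),
     vid = (\<lambda>x. cls A (VId x))\<rparr>"

definition corner_s :: "('o, 'm) smc \<Rightarrow> polarity \<Rightarrow> 'o \<Rightarrow> ('o, 'm) cell_term set" where
  "corner_s A p a = cls A (S p a)"

definition corner_r :: "('o, 'm) smc \<Rightarrow> polarity \<Rightarrow> 'o \<Rightarrow> ('o, 'm) cell_term set" where
  "corner_r A p a = cls A (R p a)"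

definition box :: "('o, 'm) smc \<Rightarrow> 'm \<Rightarrow> ('o, 'm) cell_term set" where
  "box A f = cls A (Box f)"


section \<open>Crossing cells\<close>

fun crossing_gen :: "('o, 'm) smc \<Rightarrow> 'o \<Rightarrow> 'o \<times> polarity \<Rightarrow> ('o, 'm) cell_term set" where
  "crossing_gen A c (a, Circ) =
     ((corner_r A Circ a \<parallel>\<^bsub>free_cornering A\<^esub> hid (free_cornering A) c)
       \<oslash>\<^bsub>free_cornering A\<^esub> box A (brd A a c))
       \<oslash>\<^bsub>free_cornering A\<^esub> (hid (free_cornering A) c \<parallel>\<^bsub>free_cornering A\<^esub> corner_s A Circ a)"
| "crossing_gen A c (a, Bullet) =
     ((hid (free_cornering A) c \<parallel>\<^bsub>free_cornering A\<^esub> corner_r A Bullet a)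
       \<oslash>\<^bsub>free_cornering A\<^esub> box A (brd A c a))
       \<oslash>\<^bsub>free_cornering A\<^esub> (corner_s A Bullet a \<parallel>\<^bsub>free_cornering A\<^esub> hid (free_cornering A) c)"

text \<open>The clauses for generators and for general tensors of vertical edges are
  \<open>crossing_singleton\<close> and \<open>crossing_append\<close> below.\<close>

primrec crossing :: "('o, 'm) smc \<Rightarrow> 'o \<Rightarrow> 'o vedge \<Rightarrow> ('o, 'm) cell_term set" where
  "crossing A c [] = hid (free_cornering A) c"
| "crossing A c (g # x) = crossing_gen A c g \<oslash>\<^bsub>free_cornering A\<^esub> crossing A c x"


section \<open>The free cornering is a double category\<close>

context symmetric_strict_monoidal_category
begin

lemma exchange_monoid: "monoid (exchange_monoid A)"
  by (rule monoidI) (auto simp: exchange_monoid_def)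

lemma wf_boundary:
  "wf_term A t \<Longrightarrow> t_top A t \<in> carrier (obj A) \<and> t_bot A t \<in> carrier (obj A) \<and>
     t_left t \<in> carrier (exchange_monoid A) \<and> t_right t \<in> carrier (exchange_monoid A)"
  by (induction t) (auto simp: exchange_monoid_def src_closed tgt_closed split: polarity.split)

lemma cell_eq_boundary:
  "cell_eq A s t \<Longrightarrow> wf_term A s \<and> wf_term A t \<and> t_top A s = t_top A t \<and> t_bot A s = t_bot A t \<and>
     t_left s = t_left t \<and> t_right s = t_right t"
proof (induction rule: cell_eq.induct)
  case (hassoc s t u)
  then show ?case using wf_boundary by (auto simp: objects.m_assoc)
next
  case (hunit_left t)
  then show ?case using wf_boundary by auto
next
  case (hunit_right t)
  then show ?case using wf_boundary by auto
next
  case (vunit_top t)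
  then show ?case using wf_boundary by auto
next
  case (vunit_bot t)
  then show ?case using wf_boundary by auto
qed (auto simp: exchange_monoid_def idm_arr idm_src idm_tgt cmp_arr cmp_src cmp_tgt
       tns_arr tns_src tns_tgt)

lemma cls_eq: "cell_eq A s t \<Longrightarrow> cls A s = cls A t"
  unfolding cls_def by (auto intro: cell_eq.sym cell_eq.trans)

lemma cls_eqD: "wf_term A s \<Longrightarrow> cls A s = cls A t \<Longrightarrow> cell_eq A s t"
  using cell_eq.refl cell_eq.sym unfolding cls_def by blast

lemma rep_cls: "wf_term A t \<Longrightarrow> cell_eq A t (rep (cls A t))"
  unfolding rep_def using someI[of "\<lambda>u. u \<in> cls A t" t] cell_eq.refl[of A t]
  by (simp add: cls_def)

lemma cells_fc: "cells (free_cornering A) = cls A ` {t. wf_term A t}"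
  by (auto simp: free_cornering_def quotient_def cls_def image_def)

lemma cellE:
  assumes "\<alpha> \<in> cells (free_cornering A)"
  obtains t where "\<alpha> = cls A t" "wf_term A t"
  using assms cells_fc by auto

lemma cls_cell: "wf_term A t \<Longrightarrow> cls A t \<in> cells (free_cornering A)"
  by (simp add: cells_fc)

lemma edges_fc [simp]:
  "hor (free_cornering A) = obj A" "ver (free_cornering A) = exchange_monoid A"
  by (simp_all add: free_cornering_def)

lemma boundary_fc [simp]:
  assumes "wf_term A t"
  shows "top_of (free_cornering A) (cls A t) = t_top A t"
    "bot_of (free_cornering A) (cls A t) = t_bot A t"
    "left_of (free_cornering A) (cls A t) = t_left t"
    "right_of (free_cornering A) (cls A t) = t_right t"
  using cell_eq_boundary[OF rep_cls[OF assms]] by (simp_all add: free_cornering_def)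

lemma hid_fc: "hid (free_cornering A) a = cls A (HId a)"
  and vid_fc: "vid (free_cornering A) x = cls A (VId x)"
  by (simp_all add: free_cornering_def)

lemma hcomp_fc:
  assumes "wf_term A (HComp s t)"
  shows "cls A s \<parallel>\<^bsub>free_cornering A\<^esub> cls A t = cls A (HComp s t)"
proof -
  have "cell_eq A (HComp s t) (HComp (rep (cls A s)) (rep (cls A t)))"
    using assms by (intro cell_eq.hcong rep_cls) auto
  then show ?thesis by (simp add: free_cornering_def cls_eq)
qed

lemma vcomp_fc:
  assumes "wf_term A (VComp s t)"
  shows "cls A s \<oslash>\<^bsub>free_cornering A\<^esub> cls A t = cls A (VComp s t)"
proof -
  have "cell_eq A (VComp s t) (VComp (rep (cls A s)) (rep (cls A t)))"
    using assms by (intro cell_eq.vcong rep_cls) auto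
  then show ?thesis by (simp add: free_cornering_def cls_eq)
qed

lemma exchange_carrier_Nil [simp]: "[] \<in> carrier (exchange_monoid A)"
  by (simp add: exchange_monoid_def)

lemma exchange_carrier_append [simp]:
  "x \<in> carrier (exchange_monoid A) \<Longrightarrow> y \<in> carrier (exchange_monoid A)
    \<Longrightarrow> x @ y \<in> carrier (exchange_monoid A)"
  by (auto simp: exchange_monoid_def)

lemma exchange_ops [simp]:
  "x \<otimes>\<^bsub>exchange_monoid A\<^esub> y = x @ y" "\<one>\<^bsub>exchange_monoid A\<^esub> = []"
  by (simp_all add: exchange_monoid_def)

theorem free_cornering_double_category: "single_object_double_category (free_cornering A)"
proof (intro single_object_double_category.intro single_object_double_category_axioms.intro)
  show "Group.monoid (hor (free_cornering A))" by (simp add: objects.monoid_axioms)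
  show "Group.monoid (ver (free_cornering A))" by (simp add: exchange_monoid)
qed (auto elim!: cellE
      simp: cls_cell hid_fc vid_fc hcomp_fc vcomp_fc wf_boundary
        cell_eq.hassoc[THEN cls_eq] cell_eq.vassoc[THEN cls_eq]
        cell_eq.hunit_left[THEN cls_eq] cell_eq.hunit_right[THEN cls_eq]
        cell_eq.vunit_top[THEN cls_eq] cell_eq.vunit_bot[THEN cls_eq]
        cell_eq.hid_mult[THEN cls_eq] cell_eq.vid_mult[THEN cls_eq]
        cell_eq.hid_vid_one[THEN cls_eq] cell_eq.interchange[THEN cls_eq])

lemma crossing_gen_boundary:
  assumes "c \<in> carrier (obj A)" and "a \<in> carrier (obj A)"
  shows "crossing_gen A c (a, p) \<in> cells (free_cornering A)"
    "top_of (free_cornering A) (crossing_gen A c (a, p)) = c"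
    "bot_of (free_cornering A) (crossing_gen A c (a, p)) = c"
    "left_of (free_cornering A) (crossing_gen A c (a, p)) = [(a, p)]"
    "right_of (free_cornering A) (crossing_gen A c (a, p)) = [(a, p)]"
  using assms
  by (cases p; simp add: corner_r_def corner_s_def box_def hid_fc hcomp_fc vcomp_fc cls_cell
        brd_arr brd_src brd_tgt)+

lemma crossing_boundary:
  assumes "c \<in> carrier (obj A)" and "x \<in> carrier (exchange_monoid A)"
  shows "crossing A c x \<in> cells (free_cornering A)
    \<and> top_of (free_cornering A) (crossing A c x) = c
    \<and> bot_of (free_cornering A) (crossing A c x) = c
    \<and> left_of (free_cornering A) (crossing A c x) = x
    \<and> right_of (free_cornering A) (crossing A c x) = x"
  using assms(2)
proof (induction x)
  case Nil
  then show ?case using assms(1) by (simp add: hid_fc cls_cell)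
next
  case (Cons g x)
  interpret F: single_object_double_category "free_cornering A"
    by (rule free_cornering_double_category)
  obtain a p where g: "g = (a, p)" by fastforce
  have "a \<in> carrier (obj A)" "x \<in> carrier (exchange_monoid A)"
    using Cons.prems g by (auto simp: exchange_monoid_def)
  then show ?case
    using Cons.IH crossing_gen_boundary[OF assms(1), of a p] g
    by (simp add: F.vcomp_boundary)
qed

lemma crossing_singleton:
  assumes "c \<in> carrier (obj A)" and "a \<in> carrier (obj A)"
  shows "crossing A c [(a, p)] = crossing_gen A c (a, p)"
proof -
  interpret F: single_object_double_category "free_cornering A"
    by (rule free_cornering_double_category)
  show ?thesis
    using crossing_gen_boundary[OF assms, of p] F.vcomp_unit(2) by force
qed

lemma crossing_append:
  assumes c: "c \<in> carrier (obj A)" and "x \<in> carrier (exchange_monoid A)"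
    and y: "y \<in> carrier (exchange_monoid A)"
  shows "crossing A c (x @ y) = crossing A c x \<oslash>\<^bsub>free_cornering A\<^esub> crossing A c y"
  using assms(2)
proof (induction x)
  case Nil
  interpret F: single_object_double_category "free_cornering A"
    by (rule free_cornering_double_category)
  show ?case using F.vcomp_unit(1)[of "crossing A c y"] crossing_boundary[OF c y] by simp
next
  case (Cons g x)
  interpret F: single_object_double_category "free_cornering A"
    by (rule free_cornering_double_category)
  obtain a p where g: "g = (a, p)" by fastforce
  have ax: "a \<in> carrier (obj A)" "x \<in> carrier (exchange_monoid A)"
    using Cons.prems g by (auto simp: exchange_monoid_def)
  then show ?case
    using Cons.IH crossing_gen_boundary[OF c ax(1), of p] g crossing_boundary[OF c ax(2)]
      crossing_boundary[OF c y] by (simp add: F.vcomp_assoc)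
qed

end


section \<open>Universal property\<close>

definition double_functor ::
    "('h, 'v, 'c) sodc \<Rightarrow> ('h', 'v', 'c') sodc \<Rightarrow> ('h \<Rightarrow> 'h') \<Rightarrow> ('v \<Rightarrow> 'v') \<Rightarrow> ('c \<Rightarrow> 'c') \<Rightarrow> bool"
  where
  "double_functor D E h v \<Phi> \<longleftrightarrow>
     h \<in> hom (hor D) (hor E) \<and> h \<one>\<^bsub>hor D\<^esub> = \<one>\<^bsub>hor E\<^esub> \<and>
     v \<in> hom (ver D) (ver E) \<and> v \<one>\<^bsub>ver D\<^esub> = \<one>\<^bsub>ver E\<^esub> \<and>
     (\<forall>\<alpha> \<in> cells D. \<Phi> \<alpha> \<in> cells E
        \<and> top_of E (\<Phi> \<alpha>) = h (top_of D \<alpha>) \<and> bot_of E (\<Phi> \<alpha>) = h (bot_of D \<alpha>)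
        \<and> left_of E (\<Phi> \<alpha>) = v (left_of D \<alpha>) \<and> right_of E (\<Phi> \<alpha>) = v (right_of D \<alpha>)) \<and>
     (\<forall>\<alpha> \<in> cells D. \<forall>\<beta> \<in> cells D. right_of D \<alpha> = left_of D \<beta>
        \<longrightarrow> \<Phi> (\<alpha> \<parallel>\<^bsub>D\<^esub> \<beta>) = \<Phi> \<alpha> \<parallel>\<^bsub>E\<^esub> \<Phi> \<beta>) \<and>
     (\<forall>\<alpha> \<in> cells D. \<forall>\<beta> \<in> cells D. bot_of D \<alpha> = top_of D \<beta>
        \<longrightarrow> \<Phi> (\<alpha> \<oslash>\<^bsub>D\<^esub> \<beta>) = \<Phi> \<alpha> \<oslash>\<^bsub>E\<^esub> \<Phi> \<beta>) \<and>
     (\<forall>a \<in> carrier (hor D). \<Phi> (hid D a) = hid E (h a)) \<and>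
     (\<forall>x \<in> carrier (ver D). \<Phi> (vid D x) = vid E (v x))"

text \<open>A model of the generators and equations of the free cornering in a double category \<open>D\<close>.\<close>

locale cornering_model =
  symmetric_strict_monoidal_category A + D: single_object_double_category D
  for A :: "('o, 'm) smc" and D :: "('h, 'v, 'c) sodc" +
  fixes h :: "'o \<Rightarrow> 'h" and g :: "'o \<times> polarity \<Rightarrow> 'v"
    and s r :: "polarity \<Rightarrow> 'o \<Rightarrow> 'c" and e :: "'m \<Rightarrow> 'c"
  assumes h_hom: "h \<in> hom (obj A) (hor D)" and h_one: "h \<one>\<^bsub>obj A\<^esub> = \<one>\<^bsub>hor D\<^esub>"
    and g_closed: "a \<in> carrier (obj A) \<Longrightarrow> g (a, p) \<in> carrier (ver D)"
    and s_boundary: "a \<in> carrier (obj A) \<Longrightarrow> s p a \<in> cells D"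
      "a \<in> carrier (obj A) \<Longrightarrow> top_of D (s p a) = h a"
      "a \<in> carrier (obj A) \<Longrightarrow> bot_of D (s p a) = \<one>\<^bsub>hor D\<^esub>"
      "a \<in> carrier (obj A) \<Longrightarrow> left_of D (s Circ a) = \<one>\<^bsub>ver D\<^esub>"
      "a \<in> carrier (obj A) \<Longrightarrow> right_of D (s Circ a) = g (a, Circ)"
      "a \<in> carrier (obj A) \<Longrightarrow> left_of D (s Bullet a) = g (a, Bullet)"
      "a \<in> carrier (obj A) \<Longrightarrow> right_of D (s Bullet a) = \<one>\<^bsub>ver D\<^esub>"
    and r_boundary: "a \<in> carrier (obj A) \<Longrightarrow> r p a \<in> cells D"
      "a \<in> carrier (obj A) \<Longrightarrow> top_of D (r p a) = \<one>\<^bsub>hor D\<^esub>"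
      "a \<in> carrier (obj A) \<Longrightarrow> bot_of D (r p a) = h a"
      "a \<in> carrier (obj A) \<Longrightarrow> left_of D (r Circ a) = g (a, Circ)"
      "a \<in> carrier (obj A) \<Longrightarrow> right_of D (r Circ a) = \<one>\<^bsub>ver D\<^esub>"
      "a \<in> carrier (obj A) \<Longrightarrow> left_of D (r Bullet a) = \<one>\<^bsub>ver D\<^esub>"
      "a \<in> carrier (obj A) \<Longrightarrow> right_of D (r Bullet a) = g (a, Bullet)"
    and e_boundary: "f \<in> arr A \<Longrightarrow> e f \<in> cells D"
      "f \<in> arr A \<Longrightarrow> top_of D (e f) = h (src A f)"
      "f \<in> arr A \<Longrightarrow> bot_of D (e f) = h (tgt A f)"
      "f \<in> arr A \<Longrightarrow> left_of D (e f) = \<one>\<^bsub>ver D\<^esub>"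
      "f \<in> arr A \<Longrightarrow> right_of D (e f) = \<one>\<^bsub>ver D\<^esub>"
    and yanking: "a \<in> carrier (obj A) \<Longrightarrow> s Circ a \<parallel>\<^bsub>D\<^esub> r Circ a = hid D (h a)"
      "a \<in> carrier (obj A) \<Longrightarrow> r Circ a \<oslash>\<^bsub>D\<^esub> s Circ a = vid D (g (a, Circ))"
      "a \<in> carrier (obj A) \<Longrightarrow> r Bullet a \<parallel>\<^bsub>D\<^esub> s Bullet a = hid D (h a)"
      "a \<in> carrier (obj A) \<Longrightarrow> r Bullet a \<oslash>\<^bsub>D\<^esub> s Bullet a = vid D (g (a, Bullet))"
    and e_cmp: "\<lbrakk>f \<in> arr A; f' \<in> arr A; tgt A f = src A f'\<rbrakk>
      \<Longrightarrow> e f \<oslash>\<^bsub>D\<^esub> e f' = e (cmp A f f')"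
    and e_idm: "a \<in> carrier (obj A) \<Longrightarrow> e (idm A a) = hid D (h a)"
    and e_tns: "\<lbrakk>f \<in> arr A; f' \<in> arr A\<rbrakk> \<Longrightarrow> e f \<parallel>\<^bsub>D\<^esub> e f' = e (tns A f f')"

lemma (in symmetric_strict_monoidal_category) free_cornering_model:
  "cornering_model A (free_cornering A) id (\<lambda>u. [u]) (corner_s A) (corner_r A) (box A)"
proof (intro cornering_model.intro cornering_model_axioms.intro)
  show "symmetric_strict_monoidal_category A" by (rule symmetric_strict_monoidal_category_axioms)
  show "single_object_double_category (free_cornering A)" by (rule free_cornering_double_category)
qed (auto simp: hom_def corner_s_def corner_r_def box_def cls_cell hid_fc vid_fc hcomp_fc vcomp_fc
      exchange_monoid_def
      cell_eq.yank_h_circ[THEN cls_eq] cell_eq.yank_v_circ[THEN cls_eq]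
      cell_eq.yank_h_bullet[THEN cls_eq] cell_eq.yank_v_bullet[THEN cls_eq]
      cell_eq.box_cmp[THEN cls_eq] cell_eq.box_idm[THEN cls_eq] cell_eq.box_tns[THEN cls_eq])

context cornering_model
begin

definition v_ext :: "'o vedge \<Rightarrow> 'v" where
  "v_ext x = foldr (\<lambda>u w. g u \<otimes>\<^bsub>ver D\<^esub> w) x \<one>\<^bsub>ver D\<^esub>"

primrec eval_term :: "('o, 'm) cell_term \<Rightarrow> 'c" where
  "eval_term (HId a) = hid D (h a)"
| "eval_term (VId x) = vid D (v_ext x)"
| "eval_term (S p a) = s p a"
| "eval_term (R p a) = r p a"
| "eval_term (Box f) = e f"
| "eval_term (HComp t u) = eval_term t \<parallel>\<^bsub>D\<^esub> eval_term u"
| "eval_term (VComp t u) = eval_term t \<oslash>\<^bsub>D\<^esub> eval_term u"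

lemma h_closed: "a \<in> carrier (obj A) \<Longrightarrow> h a \<in> carrier (hor D)"
  and h_mult: "a \<in> carrier (obj A) \<Longrightarrow> b \<in> carrier (obj A)
    \<Longrightarrow> h (a \<otimes>\<^bsub>obj A\<^esub> b) = h a \<otimes>\<^bsub>hor D\<^esub> h b"
  using h_hom by (auto simp: hom_def)

lemma v_ext_Nil [simp]: "v_ext [] = \<one>\<^bsub>ver D\<^esub>"
  by (simp add: v_ext_def)

lemma v_ext_closed: "x \<in> carrier (exchange_monoid A) \<Longrightarrow> v_ext x \<in> carrier (ver D)"
  by (induction x) (auto simp: v_ext_def exchange_monoid_def g_closed)

lemma v_ext_single: "a \<in> carrier (obj A) \<Longrightarrow> v_ext [(a, p)] = g (a, p)"
  by (simp add: v_ext_def g_closed)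

lemma v_ext_append:
  "x \<in> carrier (exchange_monoid A) \<Longrightarrow> y \<in> carrier (exchange_monoid A)
    \<Longrightarrow> v_ext (x @ y) = v_ext x \<otimes>\<^bsub>ver D\<^esub> v_ext y"
proof (induction x)
  case Nil
  then show ?case using v_ext_closed by simp
next
  case (Cons u x)
  then have "x \<in> carrier (exchange_monoid A)" "g u \<in> carrier (ver D)"
    by (auto simp: exchange_monoid_def intro: g_closed)
  moreover have "\<And>w. v_ext (u # w) = g u \<otimes>\<^bsub>ver D\<^esub> v_ext w" by (simp add: v_ext_def)
  ultimately show ?case using Cons v_ext_closed by (simp add: D.V.m_assoc)
qed

lemma eval_boundary:
  "wf_term A t \<Longrightarrow> eval_term t \<in> cells D
    \<and> top_of D (eval_term t) = h (t_top A t) \<and> bot_of D (eval_term t) = h (t_bot A t)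
    \<and> left_of D (eval_term t) = v_ext (t_left t) \<and> right_of D (eval_term t) = v_ext (t_right t)"
  by (induction t)
    (auto simp: D.hid_boundary D.vid_boundary D.hcomp_boundary D.vcomp_boundary
      s_boundary r_boundary e_boundary h_closed h_one h_mult v_ext_closed v_ext_append v_ext_single
      wf_boundary split: polarity.split)

lemma eval_cell_eq: "cell_eq A t u \<Longrightarrow> eval_term t = eval_term u"
proof (induction rule: cell_eq.induct)
  case (hassoc s t u)
  then show ?case using eval_boundary by (auto intro: D.hcomp_assoc)
next
  case (vassoc s t u)
  then show ?case using eval_boundary by (auto intro: D.vcomp_assoc)
next
  case (hunit_left t)
  then show ?case using eval_boundary[of t] D.hcomp_unit(1)[of "eval_term t"] by simp
next
  case (hunit_right t)
  then show ?case using eval_boundary[of t] D.hcomp_unit(2)[of "eval_term t"] by simp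
next
  case (vunit_top t)
  then show ?case using eval_boundary[of t] D.vcomp_unit(1)[of "eval_term t"] by simp
next
  case (vunit_bot t)
  then show ?case using eval_boundary[of t] D.vcomp_unit(2)[of "eval_term t"] by simp
next
  case (interchange s t s' t')
  then show ?case using eval_boundary by (auto intro: D.interchange)
qed (simp_all add: D.hid_mult D.vid_mult D.hid_vid_one h_one h_closed h_mult v_ext_closed
      v_ext_append v_ext_single yanking e_cmp e_idm e_tns)

lemma eval_rep: "wf_term A t \<Longrightarrow> eval_term (rep (cls A t)) = eval_term t"
  using eval_cell_eq rep_cls by metis

theorem free_cornering_universal_existence:
  "\<exists>v \<Phi>. double_functor (free_cornering A) D h v \<Phi> \<and>
     (\<forall>a \<in> carrier (obj A). \<forall>p. v [(a, p)] = g (a, p)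
        \<and> \<Phi> (corner_s A p a) = s p a \<and> \<Phi> (corner_r A p a) = r p a) \<and>
     (\<forall>f \<in> arr A. \<Phi> (box A f) = e f)"
proof (intro exI conjI)
  show "double_functor (free_cornering A) D h v_ext (\<lambda>\<alpha>. eval_term (rep \<alpha>))"
    unfolding double_functor_def
    using h_hom
    by (auto elim!: cellE simp: eval_rep eval_boundary h_one hom_def v_ext_closed v_ext_append
        hcomp_fc vcomp_fc hid_fc vid_fc)
qed (auto simp: v_ext_single corner_s_def corner_r_def box_def eval_rep)

theorem free_cornering_universal_uniqueness:
  assumes F: "double_functor (free_cornering A) D h v \<Phi>"
    and F': "double_functor (free_cornering A) D h v' \<Phi>'"
    and gens: "\<And>a p. a \<in> carrier (obj A) \<Longrightarrow> v [(a, p)] = v' [(a, p)]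
      \<and> \<Phi> (corner_s A p a) = \<Phi>' (corner_s A p a) \<and> \<Phi> (corner_r A p a) = \<Phi>' (corner_r A p a)"
    and boxes: "\<And>f. f \<in> arr A \<Longrightarrow> \<Phi> (box A f) = \<Phi>' (box A f)"
  shows "x \<in> carrier (exchange_monoid A) \<Longrightarrow> v x = v' x"
    and "\<alpha> \<in> cells (free_cornering A) \<Longrightarrow> \<Phi> \<alpha> = \<Phi>' \<alpha>"
proof -
  have vh: "v \<in> hom (exchange_monoid A) (ver D)" and vh': "v' \<in> hom (exchange_monoid A) (ver D)"
    using F F' unfolding double_functor_def by simp_all
  show v: "v x = v' x" if "x \<in> carrier (exchange_monoid A)" for x
    using that
  proof (induction x)
    case Nil
    have "v \<one>\<^bsub>ver (free_cornering A)\<^esub> = \<one>\<^bsub>ver D\<^esub>" "v' \<one>\<^bsub>ver (free_cornering A)\<^esub> = \<one>\<^bsub>ver D\<^esub>"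
      using F F' unfolding double_functor_def by blast+
    then show ?case by simp
  next
    case (Cons u x)
    then have c: "[u] \<in> carrier (exchange_monoid A)" "x \<in> carrier (exchange_monoid A)"
      by (auto simp: exchange_monoid_def)
    have "v ([u] @ x) = v [u] \<otimes>\<^bsub>ver D\<^esub> v x" "v' ([u] @ x) = v' [u] \<otimes>\<^bsub>ver D\<^esub> v' x"
      using hom_mult[OF vh c] hom_mult[OF vh' c] by simp_all
    moreover have "v [u] = v' [u]"
      using c(1) gens[of "fst u" "snd u"] by (auto simp: exchange_monoid_def)
    ultimately show ?case using Cons.IH c by simp
  qed
  have "\<Phi> (cls A t) = \<Phi>' (cls A t)" if "wf_term A t" for t
    using that
  proof (induction t)
    case (HId a)
    then have "\<Phi> (hid (free_cornering A) a) = \<Phi>' (hid (free_cornering A) a)"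
      using F F' unfolding double_functor_def edges_fc by (metis wf_term.simps(1))
    then show ?case by (simp add: hid_fc)
  next
    case (VId x)
    then have "\<Phi> (vid (free_cornering A) x) = \<Phi>' (vid (free_cornering A) x)"
      using F F' v unfolding double_functor_def edges_fc by (metis wf_term.simps(2))
    then show ?case by (simp add: vid_fc)
  next
    case (HComp t u)
    then have wf: "wf_term A t" "wf_term A u"
      and bd: "right_of (free_cornering A) (cls A t) = left_of (free_cornering A) (cls A u)"
      by auto
    have "\<Phi> (cls A t \<parallel>\<^bsub>free_cornering A\<^esub> cls A u) = \<Phi> (cls A t) \<parallel>\<^bsub>D\<^esub> \<Phi> (cls A u)"
      and "\<Phi>' (cls A t \<parallel>\<^bsub>free_cornering A\<^esub> cls A u) = \<Phi>' (cls A t) \<parallel>\<^bsub>D\<^esub> \<Phi>' (cls A u)"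
      using F F' bd cls_cell[OF wf(1)] cls_cell[OF wf(2)] unfolding double_functor_def by blast+
    then show ?case using HComp.IH wf hcomp_fc[OF HComp.prems] by simp
  next
    case (VComp t u)
    then have wf: "wf_term A t" "wf_term A u"
      and bd: "bot_of (free_cornering A) (cls A t) = top_of (free_cornering A) (cls A u)"
      by auto
    have "\<Phi> (cls A t \<oslash>\<^bsub>free_cornering A\<^esub> cls A u) = \<Phi> (cls A t) \<oslash>\<^bsub>D\<^esub> \<Phi> (cls A u)"
      and "\<Phi>' (cls A t \<oslash>\<^bsub>free_cornering A\<^esub> cls A u) = \<Phi>' (cls A t) \<oslash>\<^bsub>D\<^esub> \<Phi>' (cls A u)"
      using F F' bd cls_cell[OF wf(1)] cls_cell[OF wf(2)] unfolding double_functor_def by blast+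
    then show ?case using VComp.IH wf vcomp_fc[OF VComp.prems] by simp
  next
    case (S p a)
    then show ?case using gens[of a p] by (simp add: corner_s_def)
  next
    case (R p a)
    then show ?case using gens[of a p] by (simp add: corner_r_def)
  next
    case (Box f)
    then show ?case using boxes[of f] by (simp add: box_def)
  qed
  then show "\<Phi> \<alpha> = \<Phi>' \<alpha>" if "\<alpha> \<in> cells (free_cornering A)" for \<alpha>
    using that by (auto elim: cellE)
qed

end

end

theory Submission
  imports Defs
begin

text \<open>The equation says that \<open>\<alpha>\<close> slides past a wire \<open>C\<close>. By structural induction on a term
  representing \<open>\<alpha>\<close>, horizontal composites reduce to the hexagon, vertical composites to pasting,
  and boxes to naturality of the braiding. For a corner \<open>s\<close> (resp. \<open>r\<close>), the crossing cell contains
  an \<open>r\<close> (resp. \<open>s\<close>) of the same polarity, which cancels \<open>\<alpha>\<close> by yanking; the copy of \<open>\<alpha>\<close> in the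
  crossing cell survives on the other side of the wire. For polarity \<open>\<circ>\<close> the two remaining
  braidings cancel by symmetry.\<close>

section \<open>Coherence of the braiding with the unit object\<close>

context symmetric_strict_monoidal_category
begin

text \<open>The hexagon with two unit objects makes this braiding idempotent, and symmetry gives it
  a right inverse; an idempotent with a right inverse is an identity.\<close>

lemma brd_unit_right:
  assumes a: "a \<in> carrier (obj A)"
  shows "brd A a \<one>\<^bsub>obj A\<^esub> = idm A a"
proof -
  let ?s = "brd A a \<one>\<^bsub>obj A\<^esub>" and ?t = "brd A \<one>\<^bsub>obj A\<^esub> a"
  have s: "?s \<in> arr A" "src A ?s = a" "tgt A ?s = a"
    and t: "?t \<in> arr A" "src A ?t = a" "tgt A ?t = a"
    using a by (simp_all add: brd_arr brd_src brd_tgt)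
  have idem: "?s = ?s ;; ?s"
    using hexagon[OF a objects.one_closed objects.one_closed] s
    by (simp add: tns_unit_left tns_unit_right)
  have inv: "?s ;; ?t = idm A a"
    using symmetry[OF a objects.one_closed] a by simp
  have "?s = ?s ;; (?s ;; ?t)"
    using inv cmp_idm_right[OF s(1)] s by simp
  also have "\<dots> = (?s ;; ?s) ;; ?t"
    using s t by (simp add: cmp_assoc)
  also have "\<dots> = idm A a"
    using idem inv by simp
  finally show ?thesis .
qed

end

section \<open>Unit laws and interchange against an identity-padded cell\<close>

context single_object_double_category
begin

lemma hcomp_hid_one:
  assumes "\<alpha> \<in> cells D"
  shows "right_of D \<alpha> = \<one>\<^bsub>ver D\<^esub> \<Longrightarrow> \<alpha> \<parallel> hid D \<one>\<^bsub>hor D\<^esub> = \<alpha>"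
    and "left_of D \<alpha> = \<one>\<^bsub>ver D\<^esub> \<Longrightarrow> hid D \<one>\<^bsub>hor D\<^esub> \<parallel> \<alpha> = \<alpha>"
  using hcomp_unit[OF assms] by (simp_all add: hid_vid_one)

text \<open>With the boundary as a premise instead of an argument of \<open>hid\<close>, the unit
  laws still rewrite after \<open>top_of\<close> or \<open>bot_of\<close> has been computed.\<close>

lemma vcomp_hid:
  assumes "\<alpha> \<in> cells D"
  shows "top_of D \<alpha> = a \<Longrightarrow> hid D a \<oslash> \<alpha> = \<alpha>"
    and "bot_of D \<alpha> = b \<Longrightarrow> \<alpha> \<oslash> hid D b = \<alpha>"
  using vcomp_unit[OF assms] by auto

text \<open>This lemma and the next three are interchange with \<gamma> padded by an identity cell,
  below it for \<open>top\<close> and above it for \<open>bot\<close>. The suffix names the layer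
  with which \<gamma> stays aligned.\<close>

lemma vcomp_hcomp_top:
  assumes "\<alpha> \<in> cells D" "\<beta> \<in> cells D" "\<gamma> \<in> cells D" "bot_of D \<alpha> = top_of D \<beta>"
    "right_of D \<alpha> = left_of D \<gamma>" "right_of D \<beta> = \<one>\<^bsub>ver D\<^esub>"
  shows "(\<alpha> \<oslash> \<beta>) \<parallel> \<gamma> = (\<alpha> \<parallel> \<gamma>) \<oslash> (\<beta> \<parallel> hid D (bot_of D \<gamma>))"
  using interchange[of \<alpha> \<beta> \<gamma> "hid D (bot_of D \<gamma>)"] assms
  by (simp add: hid_boundary boundary_closed vcomp_unit)

lemma vcomp_hcomp_bot:
  assumes "\<alpha> \<in> cells D" "\<beta> \<in> cells D" "\<gamma> \<in> cells D" "bot_of D \<alpha> = top_of D \<beta>"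
    "right_of D \<alpha> = \<one>\<^bsub>ver D\<^esub>" "right_of D \<beta> = left_of D \<gamma>"
  shows "(\<alpha> \<oslash> \<beta>) \<parallel> \<gamma> = (\<alpha> \<parallel> hid D (top_of D \<gamma>)) \<oslash> (\<beta> \<parallel> \<gamma>)"
  using interchange[of \<alpha> \<beta> "hid D (top_of D \<gamma>)" \<gamma>] assms
  by (simp add: hid_boundary boundary_closed vcomp_unit)

lemma hcomp_vcomp_top:
  assumes "\<alpha> \<in> cells D" "\<beta> \<in> cells D" "\<gamma> \<in> cells D" "bot_of D \<alpha> = top_of D \<beta>"
    "right_of D \<gamma> = left_of D \<alpha>" "left_of D \<beta> = \<one>\<^bsub>ver D\<^esub>"
  shows "\<gamma> \<parallel> (\<alpha> \<oslash> \<beta>) = (\<gamma> \<parallel> \<alpha>) \<oslash> (hid D (bot_of D \<gamma>) \<parallel> \<beta>)"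
  using interchange[of \<gamma> "hid D (bot_of D \<gamma>)" \<alpha> \<beta>] assms
  by (simp add: hid_boundary boundary_closed vcomp_unit)

lemma hcomp_vcomp_bot:
  assumes "\<alpha> \<in> cells D" "\<beta> \<in> cells D" "\<gamma> \<in> cells D" "bot_of D \<alpha> = top_of D \<beta>"
    "left_of D \<alpha> = \<one>\<^bsub>ver D\<^esub>" "right_of D \<gamma> = left_of D \<beta>"
  shows "\<gamma> \<parallel> (\<alpha> \<oslash> \<beta>) = (hid D (top_of D \<gamma>) \<parallel> \<alpha>) \<oslash> (\<gamma> \<parallel> \<beta>)"
  using interchange[of "hid D (top_of D \<gamma>)" \<gamma> \<alpha> \<beta>] assms
  by (simp add: hid_boundary boundary_closed vcomp_unit)

end

section \<open>Braiding cells and the sliding equation in the free cornering\<close>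

context symmetric_strict_monoidal_category
begin

interpretation F: single_object_double_category "free_cornering A"
  by (rule free_cornering_double_category)

text \<open>The generators form a model in the free cornering itself, so the yanking and box laws
  become available as equations between cells.\<close>

interpretation M: cornering_model A "free_cornering A" id "\<lambda>u. [u]" "corner_s A" "corner_r A" "box A"
  by (rule free_cornering_model)

abbreviation fc_hcomp (infixl "\<parallel>\<^sub>F" 65) where "fc_hcomp \<equiv> hcomp (free_cornering A)"
abbreviation fc_vcomp (infixl "\<oslash>\<^sub>F" 60) where "fc_vcomp \<equiv> vcomp (free_cornering A)"
abbreviation fc_hid ("\<iota>") where "\<iota> \<equiv> hid (free_cornering A)"
abbreviation braid_cell ("\<tau>") where "\<tau> a b \<equiv> box A (brd A a b)"

lemmas fc_boundary = F.hid_boundary F.vid_boundary F.hcomp_boundary F.vcomp_boundary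
  M.s_boundary M.r_boundary M.e_boundary brd_arr brd_src brd_tgt

text \<open>All edges are read off \<alpha>, so an induction can carry the property for a fixed
  \<open>c\<close> without naming boundaries.\<close>

definition slides :: "'o \<Rightarrow> ('o, 'm) cell_term set \<Rightarrow> bool" where
  "slides c \<alpha> \<longleftrightarrow>
    (crossing A c (left_of (free_cornering A) \<alpha>) \<parallel>\<^sub>F \<alpha>) \<oslash>\<^sub>F \<tau> c (bot_of (free_cornering A) \<alpha>)
    = \<tau> c (top_of (free_cornering A) \<alpha>) \<oslash>\<^sub>F (\<alpha> \<parallel>\<^sub>F crossing A c (right_of (free_cornering A) \<alpha>))"

lemma braid_cell_inverse:
  assumes "a \<in> carrier (obj A)" "b \<in> carrier (obj A)"
  shows "\<tau> a b \<oslash>\<^sub>F \<tau> b a = \<iota> (a \<otimes>\<^bsub>obj A\<^esub> b)"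
  using assms by (simp add: M.e_cmp symmetry M.e_idm brd_arr brd_src brd_tgt)

text \<open>Erases the braiding cell at every unit boundary; corners have one such boundary and
  vertical identities have two.\<close>

lemma braid_cell_unit_right:
  assumes "a \<in> carrier (obj A)"
  shows "\<tau> a \<one>\<^bsub>obj A\<^esub> = \<iota> a"
  using assms by (simp add: brd_unit_right M.e_idm)

text \<open>The hexagon, transported by functoriality of \<open>box\<close>: the wire
  \<open>c\<close> crosses \<open>a\<close>, then \<open>b\<close>. It splits the braidings at the
  boundaries of a horizontal composite.\<close>

lemma braid_cell_mult:
  assumes "a \<in> carrier (obj A)" "b \<in> carrier (obj A)" "c \<in> carrier (obj A)"
  shows "\<tau> c (a \<otimes>\<^bsub>obj A\<^esub> b) = (\<tau> c a \<parallel>\<^sub>F \<iota> b) \<oslash>\<^sub>F (\<iota> a \<parallel>\<^sub>F \<tau> c b)"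
proof -
  have "(\<tau> c a \<parallel>\<^sub>F \<iota> b) \<oslash>\<^sub>F (\<iota> a \<parallel>\<^sub>F \<tau> c b)
      = box A (brd A c a \<odot> idm A b) \<oslash>\<^sub>F box A (idm A a \<odot> brd A c b)"
    using assms by (simp add: M.e_tns[symmetric] M.e_idm brd_arr idm_arr)
  also have "\<dots> = box A ((brd A c a \<odot> idm A b) ;; (idm A a \<odot> brd A c b))"
    using assms
    by (intro M.e_cmp) (simp_all add: brd_arr brd_src brd_tgt idm_arr idm_src idm_tgt
        tns_arr tns_src tns_tgt objects.m_assoc)
  finally show ?thesis using assms by (simp add: hexagon)
qed

section \<open>Sliding past identities and boxes\<close>

lemma slides_hid:
  assumes "a \<in> carrier (obj A)" "c \<in> carrier (obj A)"
  shows "slides c (\<iota> a)"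
  using assms by (simp add: slides_def fc_boundary F.hid_mult F.vcomp_hid)

text \<open>Vertical identities are horizontal units and both braidings are trivial, so each side
  collapses to \<open>crossing A c x\<close>.\<close>

lemma slides_vid:
  assumes "x \<in> carrier (exchange_monoid A)" "c \<in> carrier (obj A)"
  shows "slides c (vid (free_cornering A) x)"
proof -
  have "\<chi> \<parallel>\<^sub>F vid (free_cornering A) x = \<chi>" "vid (free_cornering A) x \<parallel>\<^sub>F \<chi> = \<chi>"
    if "\<chi> = crossing A c x" for \<chi>
    using crossing_boundary[OF assms(2,1)] F.hcomp_unit[of \<chi>] that by simp_all
  then show ?thesis
    using assms crossing_boundary[OF assms(2,1)]
    by (simp add: slides_def fc_boundary braid_cell_unit_right F.vcomp_hid)
qed

text \<open>Both crossings are the bare wire, which is \<open>box A (idm A c)\<close>. Everything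
  then lies in the image of \<open>box\<close>, and naturality at \<open>idm A c\<close> and
  \<open>f\<close> applies.\<close>

lemma slides_box:
  assumes f: "f \<in> arr A" and c: "c \<in> carrier (obj A)"
  shows "slides c (box A f)"
proof -
  have id: "\<iota> c = box A (idm A c)" using c by (simp add: M.e_idm)
  have "(\<iota> c \<parallel>\<^sub>F box A f) \<oslash>\<^sub>F \<tau> c (tgt A f) = box A ((idm A c \<odot> f) ;; brd A c (tgt A f))"
    using f c by (simp add: id M.e_tns M.e_cmp idm_arr idm_src idm_tgt tns_arr tns_src tns_tgt
        brd_arr brd_src brd_tgt tgt_closed)
  also have "\<dots> = box A (brd A c (src A f) ;; (f \<odot> idm A c))"
    using brd_natural[OF idm_arr[OF c] f] c by (simp add: idm_src idm_tgt)
  also have "\<dots> = \<tau> c (src A f) \<oslash>\<^sub>F (box A f \<parallel>\<^sub>F \<iota> c)"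
    using f c by (simp add: id M.e_tns M.e_cmp idm_arr idm_src idm_tgt tns_arr tns_src tns_tgt
        brd_arr brd_src brd_tgt src_closed)
  finally show ?thesis using f c by (simp add: slides_def fc_boundary)
qed

section \<open>Closure under the two compositions\<close>

text \<open>The wire passes \<alpha>, then \<beta>. The crossing \<open>Y\<close> on the shared edge
  appears to the right of \<alpha> and serves as the left crossing of \<beta>.\<close>

lemma slides_hcomp:
  assumes cells: "\<alpha> \<in> cells (free_cornering A)" "\<beta> \<in> cells (free_cornering A)"
    and match: "right_of (free_cornering A) \<alpha> = left_of (free_cornering A) \<beta>"
    and c: "c \<in> carrier (obj A)" and sl: "slides c \<alpha>" "slides c \<beta>"
  shows "slides c (\<alpha> \<parallel>\<^sub>F \<beta>)"
proof -
  define a a' b b' where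
    "a = top_of (free_cornering A) \<alpha>" and "a' = bot_of (free_cornering A) \<alpha>" and
    "b = top_of (free_cornering A) \<beta>" and "b' = bot_of (free_cornering A) \<beta>"
  note ab = a_def[symmetric] a'_def[symmetric] b_def[symmetric] b'_def[symmetric]
  have obs: "a \<in> carrier (obj A)" "a' \<in> carrier (obj A)" "b \<in> carrier (obj A)" "b' \<in> carrier (obj A)"
    using F.boundary_closed cells by (simp_all add: a_def a'_def b_def b'_def)
  define X Y Z where
    "X = crossing A c (left_of (free_cornering A) \<alpha>)" and
    "Y = crossing A c (left_of (free_cornering A) \<beta>)" and
    "Z = crossing A c (right_of (free_cornering A) \<beta>)"
  have ver: "left_of (free_cornering A) \<alpha> \<in> carrier (exchange_monoid A)"
    "left_of (free_cornering A) \<beta> \<in> carrier (exchange_monoid A)"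
    "right_of (free_cornering A) \<beta> \<in> carrier (exchange_monoid A)"
    using F.boundary_closed cells by simp_all
  note XYZ = crossing_boundary[OF c ver(1), folded X_def]
    crossing_boundary[OF c ver(2), folded Y_def] crossing_boundary[OF c ver(3), folded Z_def]
  note bd = XYZ cells ab match obs c fc_boundary objects.m_assoc
  have sl1: "(X \<parallel>\<^sub>F \<alpha>) \<oslash>\<^sub>F \<tau> c a' = \<tau> c a \<oslash>\<^sub>F (\<alpha> \<parallel>\<^sub>F Y)"
    and sl2: "(Y \<parallel>\<^sub>F \<beta>) \<oslash>\<^sub>F \<tau> c b' = \<tau> c b \<oslash>\<^sub>F (\<beta> \<parallel>\<^sub>F Z)"
    using sl by (simp_all add: slides_def X_def Y_def Z_def ab match)
  \<comment> \<open>While the wire passes \<alpha>, \<beta> is idle: the identity padding below it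
    is traded for one above it. In \<open>lower\<close> the roles are exchanged.\<close>
  have upper: "((X \<parallel>\<^sub>F \<alpha>) \<parallel>\<^sub>F \<beta>) \<oslash>\<^sub>F (\<tau> c a' \<parallel>\<^sub>F \<iota> b')
      = (\<tau> c a \<parallel>\<^sub>F \<iota> b) \<oslash>\<^sub>F ((\<alpha> \<parallel>\<^sub>F Y) \<parallel>\<^sub>F \<beta>)"
  proof -
    have "((X \<parallel>\<^sub>F \<alpha>) \<parallel>\<^sub>F \<beta>) \<oslash>\<^sub>F (\<tau> c a' \<parallel>\<^sub>F \<iota> b') = ((X \<parallel>\<^sub>F \<alpha>) \<oslash>\<^sub>F \<tau> c a') \<parallel>\<^sub>F (\<beta> \<oslash>\<^sub>F \<iota> b')"
      by (rule F.interchange[symmetric]) (simp_all add: bd)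
    also have "\<dots> = (\<tau> c a \<oslash>\<^sub>F (\<alpha> \<parallel>\<^sub>F Y)) \<parallel>\<^sub>F (\<iota> b \<oslash>\<^sub>F \<beta>)"
      by (simp add: sl1 F.vcomp_hid bd)
    also have "\<dots> = (\<tau> c a \<parallel>\<^sub>F \<iota> b) \<oslash>\<^sub>F ((\<alpha> \<parallel>\<^sub>F Y) \<parallel>\<^sub>F \<beta>)"
      by (rule F.interchange) (simp_all add: bd)
    finally show ?thesis .
  qed
  have lower: "(\<alpha> \<parallel>\<^sub>F (Y \<parallel>\<^sub>F \<beta>)) \<oslash>\<^sub>F (\<iota> a' \<parallel>\<^sub>F \<tau> c b')
      = (\<iota> a \<parallel>\<^sub>F \<tau> c b) \<oslash>\<^sub>F (\<alpha> \<parallel>\<^sub>F (\<beta> \<parallel>\<^sub>F Z))"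
  proof -
    have "(\<alpha> \<parallel>\<^sub>F (Y \<parallel>\<^sub>F \<beta>)) \<oslash>\<^sub>F (\<iota> a' \<parallel>\<^sub>F \<tau> c b') = (\<alpha> \<oslash>\<^sub>F \<iota> a') \<parallel>\<^sub>F ((Y \<parallel>\<^sub>F \<beta>) \<oslash>\<^sub>F \<tau> c b')"
      by (rule F.interchange[symmetric]) (simp_all add: bd)
    also have "\<dots> = (\<iota> a \<oslash>\<^sub>F \<alpha>) \<parallel>\<^sub>F (\<tau> c b \<oslash>\<^sub>F (\<beta> \<parallel>\<^sub>F Z))"
      by (simp add: sl2 F.vcomp_hid bd)
    also have "\<dots> = (\<iota> a \<parallel>\<^sub>F \<tau> c b) \<oslash>\<^sub>F (\<alpha> \<parallel>\<^sub>F (\<beta> \<parallel>\<^sub>F Z))"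
      by (rule F.interchange) (simp_all add: bd)
    finally show ?thesis .
  qed
  have "(X \<parallel>\<^sub>F (\<alpha> \<parallel>\<^sub>F \<beta>)) \<oslash>\<^sub>F \<tau> c (a' \<otimes>\<^bsub>obj A\<^esub> b')
      = (((X \<parallel>\<^sub>F \<alpha>) \<parallel>\<^sub>F \<beta>) \<oslash>\<^sub>F (\<tau> c a' \<parallel>\<^sub>F \<iota> b')) \<oslash>\<^sub>F (\<iota> a' \<parallel>\<^sub>F \<tau> c b')"
    by (simp add: braid_cell_mult F.hcomp_assoc F.vcomp_assoc bd)
  \<comment> \<open>Rebracketing hands \<open>Y\<close> over from \<alpha> to \<beta>.\<close>
  also have "\<dots> = (\<tau> c a \<parallel>\<^sub>F \<iota> b) \<oslash>\<^sub>F ((\<alpha> \<parallel>\<^sub>F (Y \<parallel>\<^sub>F \<beta>)) \<oslash>\<^sub>F (\<iota> a' \<parallel>\<^sub>F \<tau> c b'))"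
    unfolding upper by (simp add: F.hcomp_assoc F.vcomp_assoc bd)
  also have "\<dots> = \<tau> c (a \<otimes>\<^bsub>obj A\<^esub> b) \<oslash>\<^sub>F ((\<alpha> \<parallel>\<^sub>F \<beta>) \<parallel>\<^sub>F Z)"
    by (simp add: lower braid_cell_mult F.hcomp_assoc F.vcomp_assoc bd)
  finally show ?thesis
    using cells match by (simp add: slides_def F.hcomp_boundary ab X_def Z_def)
qed

text \<open>The crossings split by \<open>crossing_append\<close>, so interchange separates the two
  layers. The braiding below \<beta> then moves up past \<beta> by \<open>sl2\<close> and past
  \<alpha> by \<open>sl1\<close>.\<close>

lemma slides_vcomp:
  assumes cells: "\<alpha> \<in> cells (free_cornering A)" "\<beta> \<in> cells (free_cornering A)"
    and match: "bot_of (free_cornering A) \<alpha> = top_of (free_cornering A) \<beta>"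
    and c: "c \<in> carrier (obj A)" and sl: "slides c \<alpha>" "slides c \<beta>"
  shows "slides c (\<alpha> \<oslash>\<^sub>F \<beta>)"
proof -
  define a b d where
    "a = top_of (free_cornering A) \<alpha>" and "b = top_of (free_cornering A) \<beta>" and
    "d = bot_of (free_cornering A) \<beta>"
  note ab = a_def[symmetric] b_def[symmetric] d_def[symmetric]
  have obs: "a \<in> carrier (obj A)" "b \<in> carrier (obj A)" "d \<in> carrier (obj A)"
    using F.boundary_closed cells by (simp_all add: a_def b_def d_def)
  define X X' Y Y' where
    "X = crossing A c (left_of (free_cornering A) \<alpha>)" and
    "X' = crossing A c (left_of (free_cornering A) \<beta>)" and
    "Y = crossing A c (right_of (free_cornering A) \<alpha>)" and
    "Y' = crossing A c (right_of (free_cornering A) \<beta>)"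
  have ver: "left_of (free_cornering A) \<alpha> \<in> carrier (exchange_monoid A)"
    "left_of (free_cornering A) \<beta> \<in> carrier (exchange_monoid A)"
    "right_of (free_cornering A) \<alpha> \<in> carrier (exchange_monoid A)"
    "right_of (free_cornering A) \<beta> \<in> carrier (exchange_monoid A)"
    using F.boundary_closed cells by simp_all
  note XY = crossing_boundary[OF c ver(1), folded X_def]
    crossing_boundary[OF c ver(2), folded X'_def] crossing_boundary[OF c ver(3), folded Y_def]
    crossing_boundary[OF c ver(4), folded Y'_def]
  note bd = XY cells ab match obs c fc_boundary
  have sl1: "(X \<parallel>\<^sub>F \<alpha>) \<oslash>\<^sub>F \<tau> c b = \<tau> c a \<oslash>\<^sub>F (\<alpha> \<parallel>\<^sub>F Y)"
    and sl2: "(X' \<parallel>\<^sub>F \<beta>) \<oslash>\<^sub>F \<tau> c d = \<tau> c b \<oslash>\<^sub>F (\<beta> \<parallel>\<^sub>F Y')"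
    using sl by (simp_all add: slides_def X_def X'_def Y_def Y'_def ab match)
  have "((X \<oslash>\<^sub>F X') \<parallel>\<^sub>F (\<alpha> \<oslash>\<^sub>F \<beta>)) \<oslash>\<^sub>F \<tau> c d = ((X \<parallel>\<^sub>F \<alpha>) \<oslash>\<^sub>F (X' \<parallel>\<^sub>F \<beta>)) \<oslash>\<^sub>F \<tau> c d"
    by (simp add: F.interchange bd)
  also have "\<dots> = (X \<parallel>\<^sub>F \<alpha>) \<oslash>\<^sub>F (\<tau> c b \<oslash>\<^sub>F (\<beta> \<parallel>\<^sub>F Y'))"
    by (simp add: F.vcomp_assoc bd flip: sl2)
  also have "\<dots> = (\<tau> c a \<oslash>\<^sub>F (\<alpha> \<parallel>\<^sub>F Y)) \<oslash>\<^sub>F (\<beta> \<parallel>\<^sub>F Y')"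
    by (simp add: bd flip: sl1 F.vcomp_assoc)
  also have "\<dots> = \<tau> c a \<oslash>\<^sub>F ((\<alpha> \<oslash>\<^sub>F \<beta>) \<parallel>\<^sub>F (Y \<oslash>\<^sub>F Y'))"
    by (simp add: F.interchange F.vcomp_assoc bd)
  finally show ?thesis
    using cells match c ver
    by (simp add: slides_def F.vcomp_boundary ab crossing_append X_def X'_def Y_def Y'_def)
qed

section \<open>Sliding past corners\<close>

text \<open>The bottom of \<open>s\<close> is the unit, so \<open>s\<close> can sit beside the top
  layer of the crossing cell, where the matching \<open>r\<close> is; the lower layers are left
  unchanged.\<close>

lemma slides_corner_s:
  assumes a: "a \<in> carrier (obj A)" and c: "c \<in> carrier (obj A)"
  shows "slides c (corner_s A p a)"
proof (cases p)
  case Circ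
  let ?s = "corner_s A Circ a" and ?r = "corner_r A Circ a"
  \<comment> \<open>Below, \<open>[simplified]\<close> restates the units of \<open>hor\<close> and
    \<open>ver\<close> in the normal form that the goal takes under \<open>edges_fc\<close>.\<close>
  have "?s \<parallel>\<^sub>F crossing_gen A c (a, Circ)
      = ((?s \<parallel>\<^sub>F (?r \<parallel>\<^sub>F \<iota> c)) \<oslash>\<^sub>F \<tau> a c) \<oslash>\<^sub>F (\<iota> c \<parallel>\<^sub>F ?s)"
    using a c
    by (simp add: F.hcomp_vcomp_top F.hcomp_hid_one[simplified] fc_boundary)
  also have "?s \<parallel>\<^sub>F (?r \<parallel>\<^sub>F \<iota> c) = \<iota> (a \<otimes>\<^bsub>obj A\<^esub> c)"
    using a c M.yanking(1)[OF a] by (simp flip: F.hcomp_assoc add: fc_boundary F.hid_mult)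
  \<comment> \<open>After yanking, the crossing cell still contains \<open>\<tau> a c\<close>, which
    the outer \<open>\<tau> c a\<close> undoes.\<close>
  finally have "\<tau> c a \<oslash>\<^sub>F (?s \<parallel>\<^sub>F crossing_gen A c (a, Circ)) = \<iota> c \<parallel>\<^sub>F ?s"
    using a c
    by (simp add: F.vcomp_hid fc_boundary braid_cell_inverse flip: F.vcomp_assoc)
  \<comment> \<open>The crossing cell must stay folded here, so that the equation just obtained
    matches.\<close>
  then show ?thesis
    using a c Circ
    by (simp add: slides_def fc_boundary braid_cell_unit_right F.vcomp_hid crossing_singleton
        del: crossing_gen.simps crossing.simps(2))
next
  case Bullet
  let ?s = "corner_s A Bullet a" and ?r = "corner_r A Bullet a"
  have "crossing_gen A c (a, Bullet) \<parallel>\<^sub>F ?s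
      = (((\<iota> c \<parallel>\<^sub>F ?r) \<parallel>\<^sub>F ?s) \<oslash>\<^sub>F \<tau> c a) \<oslash>\<^sub>F (?s \<parallel>\<^sub>F \<iota> c)"
    using a c
    by (simp add: F.vcomp_hcomp_top F.hcomp_hid_one[simplified] fc_boundary)
  also have "(\<iota> c \<parallel>\<^sub>F ?r) \<parallel>\<^sub>F ?s = \<iota> (c \<otimes>\<^bsub>obj A\<^esub> a)"
    using a c M.yanking(3)[OF a] by (simp add: F.hcomp_assoc fc_boundary F.hid_mult)
  \<comment> \<open>The braiding inside this crossing cell is already the one required on top of the
    right-hand side.\<close>
  finally have "crossing_gen A c (a, Bullet) \<parallel>\<^sub>F ?s = \<tau> c a \<oslash>\<^sub>F (?s \<parallel>\<^sub>F \<iota> c)"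
    using a c by (simp add: F.vcomp_hid fc_boundary)
  then show ?thesis
    using a c Bullet
    by (simp add: slides_def fc_boundary braid_cell_unit_right F.vcomp_hid crossing_singleton
        del: crossing_gen.simps crossing.simps(2))
qed

text \<open>Dually, the top of \<open>r\<close> is the unit, so \<open>r\<close> is aligned with the
  bottom layer of the crossing cell, which contains the matching \<open>s\<close>.\<close>

lemma slides_corner_r:
  assumes a: "a \<in> carrier (obj A)" and c: "c \<in> carrier (obj A)"
  shows "slides c (corner_r A p a)"
proof (cases p)
  case Circ
  let ?s = "corner_s A Circ a" and ?r = "corner_r A Circ a"
  have "crossing_gen A c (a, Circ) \<parallel>\<^sub>F ?r
      = ((?r \<parallel>\<^sub>F \<iota> c) \<oslash>\<^sub>F \<tau> a c) \<oslash>\<^sub>F ((\<iota> c \<parallel>\<^sub>F ?s) \<parallel>\<^sub>F ?r)"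
    using a c
    by (simp add: F.vcomp_hcomp_bot F.hcomp_hid_one[simplified] fc_boundary)
  also have "(\<iota> c \<parallel>\<^sub>F ?s) \<parallel>\<^sub>F ?r = \<iota> (c \<otimes>\<^bsub>obj A\<^esub> a)"
    using a c M.yanking(1)[OF a] by (simp add: F.hcomp_assoc fc_boundary F.hid_mult)
  finally have "(crossing_gen A c (a, Circ) \<parallel>\<^sub>F ?r) \<oslash>\<^sub>F \<tau> c a = ?r \<parallel>\<^sub>F \<iota> c"
    using a c
    by (simp add: F.vcomp_hid fc_boundary braid_cell_inverse F.vcomp_assoc)
  then show ?thesis
    using a c Circ
    by (simp add: slides_def fc_boundary braid_cell_unit_right F.vcomp_hid crossing_singleton
        del: crossing_gen.simps crossing.simps(2))
next
  case Bullet
  let ?s = "corner_s A Bullet a" and ?r = "corner_r A Bullet a"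
  have "?r \<parallel>\<^sub>F crossing_gen A c (a, Bullet)
      = ((\<iota> c \<parallel>\<^sub>F ?r) \<oslash>\<^sub>F \<tau> c a) \<oslash>\<^sub>F (?r \<parallel>\<^sub>F (?s \<parallel>\<^sub>F \<iota> c))"
    using a c
    by (simp add: F.hcomp_vcomp_bot F.hcomp_hid_one[simplified] fc_boundary)
  also have "?r \<parallel>\<^sub>F (?s \<parallel>\<^sub>F \<iota> c) = \<iota> (a \<otimes>\<^bsub>obj A\<^esub> c)"
    using a c M.yanking(3)[OF a] by (simp flip: F.hcomp_assoc add: fc_boundary F.hid_mult)
  \<comment> \<open>What survives of the crossing cell is exactly the left-hand side, with its
    braiding at the bottom.\<close>
  finally have "?r \<parallel>\<^sub>F crossing_gen A c (a, Bullet) = (\<iota> c \<parallel>\<^sub>F ?r) \<oslash>\<^sub>F \<tau> c a"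
    using a c by (simp add: F.vcomp_hid fc_boundary)
  then show ?thesis
    using a c Bullet
    by (simp add: slides_def fc_boundary braid_cell_unit_right F.vcomp_hid crossing_singleton
        del: crossing_gen.simps crossing.simps(2))
qed

text \<open>Since \<open>slides\<close> speaks of classes, it is invariant under
  \<open>cell_eq\<close> from the outset, and one case per term constructor suffices.\<close>

lemma slides_cls:
  assumes c: "c \<in> carrier (obj A)"
  shows "wf_term A t \<Longrightarrow> slides c (cls A t)"
proof (induction t)
  case (HId a)
  then show ?case using slides_hid[OF _ c] by (simp add: hid_fc)
next
  case (VId x)
  then show ?case using slides_vid[OF _ c] by (simp add: vid_fc)
next
  case (S p a)
  then show ?case using slides_corner_s[OF _ c] by (simp add: corner_s_def)
next
  case (R p a)
  then show ?case using slides_corner_r[OF _ c] by (simp add: corner_r_def)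
next
  case (Box f)
  then show ?case using slides_box[OF _ c] by (simp add: box_def)
next
  case (HComp t u)
  then have "slides c (cls A t \<parallel>\<^sub>F cls A u)"
    using c by (intro slides_hcomp) (auto simp: cls_cell)
  then show ?case using HComp.prems by (simp add: hcomp_fc)
next
  case (VComp t u)
  then have "slides c (cls A t \<oslash>\<^sub>F cls A u)"
    using c by (intro slides_vcomp) (auto simp: cls_cell)
  then show ?case using VComp.prems by (simp add: vcomp_fc)
qed

end

theorem lemma4p5:
  fixes A :: "('o, 'm) smc" and \<alpha> :: "('o, 'm) cell_term set"
    and a b c :: 'o and x y :: "'o vedge"
  assumes "symmetric_strict_monoidal_category A"
    and "\<alpha> \<in> cells (free_cornering A)"
    and "top_of (free_cornering A) \<alpha> = a"
    and "bot_of (free_cornering A) \<alpha> = b"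
    and "left_of (free_cornering A) \<alpha> = x"
    and "right_of (free_cornering A) \<alpha> = y"
    and "c \<in> carrier (obj A)"
  shows "(crossing A c x \<parallel>\<^bsub>free_cornering A\<^esub> \<alpha>) \<oslash>\<^bsub>free_cornering A\<^esub> box A (brd A c b)
       = box A (brd A c a) \<oslash>\<^bsub>free_cornering A\<^esub> (\<alpha> \<parallel>\<^bsub>free_cornering A\<^esub> crossing A c y)"
proof -
  interpret symmetric_strict_monoidal_category A by (rule assms(1))
  obtain t where "\<alpha> = cls A t" "wf_term A t"
    using assms(2) by (rule cellE)
  then have "slides c \<alpha>"
    using slides_cls assms(7) by simp
  then show ?thesis
    using assms(3-6) by (simp add: slides_def)
qed

end
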